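(* Let $R$ be a ring, let $M$ be any object $\mu_M\colon M_0\to M_1$ of $\mathrm{Morph}(\mathrm{Mod}\text{-}R)$ and let $E_M$ be its endomorphism ring in $\mathrm{Morph}(\mathrm{Mod}\text{-}R)$. Let $\varepsilon\colon E_M\to\mathrm{End}_R(M_0)\times\mathrm{End}_R(M_1)$ be the inclusion, let $\pi_i\colon \mathrm{End}_R(M_0)\times\mathrm{End}_R(M_1)\to\mathrm{End}_R(M_i)$, for $i=0,1$, be the canonical projections, and let $E_i:=\pi_i\varepsilon(E_M)$, a subring of $\mathrm{End}_R(M_i)$. Then the ring $E_M$ is local if and only if one of the following three conditions holds: (1) $M_0=0$ and $\mathrm{End}_R(M_1)$ is a local ring. (2) $M_1=0$ and $\mathrm{End}_R(M_0)$ is a local ring. (3) $M_0\neq 0$, $M_1\neq 0$ and, for every endomorphism $u=(u_0,u_1)\in E_M$: (a) either $u_0$ or $1-u_0$ is invertible in $E_0$, and (b) $u_0$ is invertible in $E_0$ if and only if $u_1$ is invertible in $E_1$.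
   Context: Rings are associative with identity; a local ring is in particular nonzero. $\mathrm{Morph}(\mathrm{Mod}\text{-}R)$ is the category whose objects are the right $R$-module homomorphisms; an object $M$ is a homomorphism $\mu_M\colon M_0\to M_1$. A morphism $u\colon M\to N$ is a pair $(u_0,u_1)$ of right $R$-module homomorphisms $u_0\colon M_0\to N_0$, $u_1\colon M_1\to N_1$ with $u_1\mu_M=\mu_N u_0$; composition and addition are componentwise. Thus $E_M$ is the set of all $(u_0,u_1)\in \mathrm{End}_R(M_0)\times\mathrm{End}_R(M_1)$ with $u_1\mu_M=\mu_M u_0$, with componentwise operations. *)

theory Defs
  imports "HOL-Algebra.Subrings" "HOL-Algebra.Chinese_Remainder"
begin

section \<open>Local rings\<close>

locale right_ideal = additive_subgroup I R + ring R for I and R (structure) +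
  assumes I_r_closed: "\<lbrakk>a \<in> I; x \<in> carrier R\<rbrakk> \<Longrightarrow> a \<otimes> x \<in> I"

locale maximal_right_ideal = right_ideal +
  assumes I_notcarr: "carrier R \<noteq> I"
    and I_maximal: "\<lbrakk>right_ideal J R; I \<subseteq> J; J \<subseteq> carrier R\<rbrakk> \<Longrightarrow> J = I \<or> J = carrier R"

text \<open>The zero ring has no proper right ideal, so it is excluded.\<close>

locale local_ring = ring R for R (structure) +
  assumes unique_maximal_right_ideal: "\<exists>!I. maximal_right_ideal I R"

section \<open>Right modules and their homomorphisms\<close>

text \<open>The locale \<^locale>\<open>module\<close> of HOL-Algebra is for left modules over commutative rings.
  Only the additive part of the ring record underlying a module is used.\<close>

record ('a, 'b) right_module = "'b ring" +
  rsmult :: "['b, 'a] \<Rightarrow> 'b" (infixl \<open>\<star>\<index>\<close> 70)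

locale right_module = R?: ring R + M?: abelian_group M
  for R :: "('a, 'm) ring_scheme" (structure)
    and M :: "('a, 'b, 'n) right_module_scheme" (structure) +
  assumes rsmult_closed:
      "\<lbrakk>x \<in> carrier M; a \<in> carrier R\<rbrakk> \<Longrightarrow> x \<star>\<^bsub>M\<^esub> a \<in> carrier M"
    and rsmult_add_scalar:
      "\<lbrakk>x \<in> carrier M; a \<in> carrier R; b \<in> carrier R\<rbrakk> \<Longrightarrow>
        x \<star>\<^bsub>M\<^esub> (a \<oplus> b) = x \<star>\<^bsub>M\<^esub> a \<oplus>\<^bsub>M\<^esub> x \<star>\<^bsub>M\<^esub> b"
    and rsmult_add_vector:
      "\<lbrakk>x \<in> carrier M; y \<in> carrier M; a \<in> carrier R\<rbrakk> \<Longrightarrow>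
        (x \<oplus>\<^bsub>M\<^esub> y) \<star>\<^bsub>M\<^esub> a = x \<star>\<^bsub>M\<^esub> a \<oplus>\<^bsub>M\<^esub> y \<star>\<^bsub>M\<^esub> a"
    and rsmult_assoc:
      "\<lbrakk>x \<in> carrier M; a \<in> carrier R; b \<in> carrier R\<rbrakk> \<Longrightarrow>
        x \<star>\<^bsub>M\<^esub> (a \<otimes> b) = (x \<star>\<^bsub>M\<^esub> a) \<star>\<^bsub>M\<^esub> b"
    and rsmult_one: "x \<in> carrier M \<Longrightarrow> x \<star>\<^bsub>M\<^esub> \<one> = x"

text \<open>Homomorphisms are extensional (\<^const>\<open>undefined\<close> outside the carrier of the domain), so that
  HOL equality of homomorphisms is equality of maps on the carrier.\<close>

definition rmod_hom ::
    "('a, 'm) ring_scheme \<Rightarrow> ('a, 'b, 'n) right_module_scheme \<Rightarrow>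
      ('a, 'c, 'k) right_module_scheme \<Rightarrow> ('b \<Rightarrow> 'c) set"
  where "rmod_hom R M N =
    {f \<in> carrier M \<rightarrow>\<^sub>E carrier N.
      (\<forall>x \<in> carrier M. \<forall>y \<in> carrier M. f (x \<oplus>\<^bsub>M\<^esub> y) = f x \<oplus>\<^bsub>N\<^esub> f y) \<and>
      (\<forall>x \<in> carrier M. \<forall>a \<in> carrier R. f (x \<star>\<^bsub>M\<^esub> a) = f x \<star>\<^bsub>N\<^esub> a)}"

definition rmod_End ::
    "('a, 'm) ring_scheme \<Rightarrow> ('a, 'b, 'n) right_module_scheme \<Rightarrow> ('b \<Rightarrow> 'b) ring"
  where "rmod_End R M =
    \<lparr>carrier = rmod_hom R M M,
     monoid.mult = compose (carrier M),
     one = (\<lambda>x \<in> carrier M. x),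
     zero = (\<lambda>x \<in> carrier M. \<zero>\<^bsub>M\<^esub>),
     add = (\<lambda>f g. \<lambda>x \<in> carrier M. f x \<oplus>\<^bsub>M\<^esub> g x)\<rparr>"

section \<open>The category of module homomorphisms\<close>

locale morph_object =
  fixes R :: "('a, 'm) ring_scheme"
    and M0 :: "('a, 'b, 'n) right_module_scheme"
    and M1 :: "('a, 'c, 'k) right_module_scheme"
    and \<mu> :: "'b \<Rightarrow> 'c"
  assumes right_module_dom: "right_module R M0"
    and right_module_cod: "right_module R M1"
    and hom: "\<mu> \<in> rmod_hom R M0 M1"

definition morph_hom ::
    "('a, 'm) ring_scheme \<Rightarrow>
      ('a, 'b, 'n) right_module_scheme \<Rightarrow> ('a, 'c, 'k) right_module_scheme \<Rightarrow> ('b \<Rightarrow> 'c) \<Rightarrow>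
      ('a, 'd, 'p) right_module_scheme \<Rightarrow> ('a, 'e, 'q) right_module_scheme \<Rightarrow> ('d \<Rightarrow> 'e) \<Rightarrow>
      (('b \<Rightarrow> 'd) \<times> ('c \<Rightarrow> 'e)) set"
  where "morph_hom R M0 M1 \<mu> N0 N1 \<nu> =
    {(u0, u1). u0 \<in> rmod_hom R M0 N0 \<and> u1 \<in> rmod_hom R M1 N1 \<and>
      compose (carrier M0) u1 \<mu> = compose (carrier M0) \<nu> u0}"

definition morph_End ::
    "('a, 'm) ring_scheme \<Rightarrow>
      ('a, 'b, 'n) right_module_scheme \<Rightarrow> ('a, 'c, 'k) right_module_scheme \<Rightarrow> ('b \<Rightarrow> 'c) \<Rightarrow>
      (('b \<Rightarrow> 'b) \<times> ('c \<Rightarrow> 'c)) ring"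
  where "morph_End R M0 M1 \<mu> =
    (RDirProd (rmod_End R M0) (rmod_End R M1)) \<lparr>carrier := morph_hom R M0 M1 \<mu> M0 M1 \<mu>\<rparr>"

text \<open>The images of the endomorphism ring under the two projections. The inclusion into the
  product ring is the identity on elements and is therefore not written.\<close>

definition morph_End0 ::
    "('a, 'm) ring_scheme \<Rightarrow>
      ('a, 'b, 'n) right_module_scheme \<Rightarrow> ('a, 'c, 'k) right_module_scheme \<Rightarrow> ('b \<Rightarrow> 'c) \<Rightarrow>
      ('b \<Rightarrow> 'b) ring"
  where "morph_End0 R M0 M1 \<mu> =
    (rmod_End R M0) \<lparr>carrier := fst ` carrier (morph_End R M0 M1 \<mu>)\<rparr>"

definition morph_End1 ::
    "('a, 'm) ring_scheme \<Rightarrow>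
      ('a, 'b, 'n) right_module_scheme \<Rightarrow> ('a, 'c, 'k) right_module_scheme \<Rightarrow> ('b \<Rightarrow> 'c) \<Rightarrow>
      ('c \<Rightarrow> 'c) ring"
  where "morph_End1 R M0 M1 \<mu> =
    (rmod_End R M1) \<lparr>carrier := snd ` carrier (morph_End R M0 M1 \<mu>)\<rparr>"

section \<open>The structures above are rings\<close>

lemma rmod_homI:
  assumes "f \<in> carrier M \<rightarrow>\<^sub>E carrier N"
    and "\<And>x y. \<lbrakk>x \<in> carrier M; y \<in> carrier M\<rbrakk> \<Longrightarrow> f (x \<oplus>\<^bsub>M\<^esub> y) = f x \<oplus>\<^bsub>N\<^esub> f y"
    and "\<And>x a. \<lbrakk>x \<in> carrier M; a \<in> carrier R\<rbrakk> \<Longrightarrow> f (x \<star>\<^bsub>M\<^esub> a) = f x \<star>\<^bsub>N\<^esub> a"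
  shows "f \<in> rmod_hom R M N"
  using assms by (auto simp: rmod_hom_def)

lemma rmod_hom_closed: "\<lbrakk>f \<in> rmod_hom R M N; x \<in> carrier M\<rbrakk> \<Longrightarrow> f x \<in> carrier N"
  and rmod_hom_add: "\<lbrakk>f \<in> rmod_hom R M N; x \<in> carrier M; y \<in> carrier M\<rbrakk> \<Longrightarrow>
    f (x \<oplus>\<^bsub>M\<^esub> y) = f x \<oplus>\<^bsub>N\<^esub> f y"
  and rmod_hom_rsmult: "\<lbrakk>f \<in> rmod_hom R M N; x \<in> carrier M; a \<in> carrier R\<rbrakk> \<Longrightarrow>
    f (x \<star>\<^bsub>M\<^esub> a) = f x \<star>\<^bsub>N\<^esub> a"
  and rmod_hom_extensional: "f \<in> rmod_hom R M N \<Longrightarrow> f \<in> extensional (carrier M)"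
  by (auto simp: rmod_hom_def PiE_def)

lemmas rmod_hom_rules = rmod_hom_closed rmod_hom_add rmod_hom_rsmult

lemma rmod_hom_eqI:
  assumes "f \<in> rmod_hom R M N" "g \<in> rmod_hom R M N" "\<And>x. x \<in> carrier M \<Longrightarrow> f x = g x"
  shows "f = g"
  using assms by (meson extensionalityI rmod_hom_extensional)

lemma rmod_hom_zero:
  assumes "right_module R M" "right_module R N" "f \<in> rmod_hom R M N"
  shows "f \<zero>\<^bsub>M\<^esub> = \<zero>\<^bsub>N\<^esub>"
proof -
  interpret M: right_module R M by fact
  interpret N: right_module R N by fact
  have c: "f \<zero>\<^bsub>M\<^esub> \<in> carrier N" using assms(3) by (simp add: rmod_hom_closed)
  have "f \<zero>\<^bsub>M\<^esub> \<oplus>\<^bsub>N\<^esub> f \<zero>\<^bsub>M\<^esub> = f \<zero>\<^bsub>M\<^esub>"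
    using rmod_hom_add[OF assms(3), of "\<zero>\<^bsub>M\<^esub>" "\<zero>\<^bsub>M\<^esub>"] by simp
  then show ?thesis using c by simp
qed

lemma (in right_module) rsmult_zero_vector:
  assumes "a \<in> carrier R" shows "\<zero>\<^bsub>M\<^esub> \<star>\<^bsub>M\<^esub> a = \<zero>\<^bsub>M\<^esub>"
proof -
  have c: "\<zero>\<^bsub>M\<^esub> \<star>\<^bsub>M\<^esub> a \<in> carrier M" using assms by (simp add: rsmult_closed)
  have "\<zero>\<^bsub>M\<^esub> \<star>\<^bsub>M\<^esub> a \<oplus>\<^bsub>M\<^esub> \<zero>\<^bsub>M\<^esub> \<star>\<^bsub>M\<^esub> a = \<zero>\<^bsub>M\<^esub> \<star>\<^bsub>M\<^esub> a"
    using rsmult_add_vector[of "\<zero>\<^bsub>M\<^esub>" "\<zero>\<^bsub>M\<^esub>" a] assms by simp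
  then show ?thesis using c by simp
qed

lemma (in right_module) rsmult_minus_vector:
  assumes "x \<in> carrier M" "a \<in> carrier R" shows "(\<ominus>\<^bsub>M\<^esub> x) \<star>\<^bsub>M\<^esub> a = \<ominus>\<^bsub>M\<^esub> (x \<star>\<^bsub>M\<^esub> a)"
proof -
  have "(\<ominus>\<^bsub>M\<^esub> x) \<star>\<^bsub>M\<^esub> a \<oplus>\<^bsub>M\<^esub> x \<star>\<^bsub>M\<^esub> a = \<zero>\<^bsub>M\<^esub>"
    using rsmult_add_vector[of "\<ominus>\<^bsub>M\<^esub> x" x a] assms by (simp add: M.l_neg rsmult_zero_vector)
  then show ?thesis
    using M.minus_equality[of "(\<ominus>\<^bsub>M\<^esub> x) \<star>\<^bsub>M\<^esub> a" "x \<star>\<^bsub>M\<^esub> a"] assms by (simp add: rsmult_closed)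
qed

lemma (in right_module) rmod_End_neg:
  assumes f: "f \<in> rmod_hom R M M"
  shows "(\<lambda>x \<in> carrier M. \<ominus>\<^bsub>M\<^esub> f x) \<in> rmod_hom R M M"
  by (rule rmod_homI)
    (use f in \<open>auto simp: rmod_hom_rules rsmult_closed rsmult_minus_vector M.minus_add\<close>)

lemma (in right_module) rmod_End_closed:
  shows rmod_End_compose_closed: "\<lbrakk>f \<in> rmod_hom R M M; g \<in> rmod_hom R M M\<rbrakk> \<Longrightarrow>
      compose (carrier M) f g \<in> rmod_hom R M M"
    and rmod_End_add_closed: "\<lbrakk>f \<in> rmod_hom R M M; g \<in> rmod_hom R M M\<rbrakk> \<Longrightarrow>
      (\<lambda>x \<in> carrier M. f x \<oplus>\<^bsub>M\<^esub> g x) \<in> rmod_hom R M M"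
    and rmod_End_one_closed: "(\<lambda>x \<in> carrier M. x) \<in> rmod_hom R M M"
    and rmod_End_zero_closed: "(\<lambda>x \<in> carrier M. \<zero>\<^bsub>M\<^esub>) \<in> rmod_hom R M M"
  by (rule rmod_homI;
      auto simp: compose_def rmod_hom_rules rsmult_closed rsmult_add_vector
        rsmult_zero_vector M.a_ac)+

lemma (in right_module) rmod_End_ring: "ring (rmod_End R M)"
proof (intro ringI abelian_groupI monoidI)
  fix f assume f: "f \<in> carrier (rmod_End R M)"
  show "\<exists>g \<in> carrier (rmod_End R M). g \<oplus>\<^bsub>rmod_End R M\<^esub> f = \<zero>\<^bsub>rmod_End R M\<^esub>"
    by (rule bexI[of _ "\<lambda>x \<in> carrier M. \<ominus>\<^bsub>M\<^esub> f x"])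
      (use f in \<open>auto simp: rmod_End_def rmod_End_neg rmod_hom_closed M.l_neg\<close>)
qed ((rule rmod_hom_eqI[of _ R M M];
        simp add: rmod_End_def rmod_End_closed rmod_hom_rules compose_eq restrict_apply' M.a_ac
          del: restrict_apply) |
      simp add: rmod_End_def rmod_End_closed)+

lemma (in right_module) rmod_End_a_inv:
  assumes f: "f \<in> rmod_hom R M M"
  shows "\<ominus>\<^bsub>rmod_End R M\<^esub> f = (\<lambda>x \<in> carrier M. \<ominus>\<^bsub>M\<^esub> f x)"
proof (rule abelian_group.minus_equality)
  show "abelian_group (rmod_End R M)" by (rule ring.is_abelian_group[OF rmod_End_ring])
  show "(\<lambda>x \<in> carrier M. \<ominus>\<^bsub>M\<^esub> f x) \<oplus>\<^bsub>rmod_End R M\<^esub> f = \<zero>\<^bsub>rmod_End R M\<^esub>"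
    using f by (auto simp: rmod_End_def rmod_hom_closed M.l_neg)
qed (use f in \<open>auto simp: rmod_End_def rmod_End_neg\<close>)

lemma ring_hom_fst: "fst \<in> ring_hom (RDirProd A B) A"
  and ring_hom_snd: "snd \<in> ring_hom (RDirProd A B) B"
  by (auto simp: ring_hom_def RDirProd_def DirProd_def monoid.defs)

lemma RDirProd_a_inv:
  assumes "ring A" "ring B" "a \<in> carrier A" "b \<in> carrier B"
  shows "\<ominus>\<^bsub>RDirProd A B\<^esub> (a, b) = (\<ominus>\<^bsub>A\<^esub> a, \<ominus>\<^bsub>B\<^esub> b)"
proof -
  interpret A: ring A by fact
  interpret B: ring B by fact
  interpret P: ring "RDirProd A B" by (rule RDirProd_ring) fact+
  show ?thesis
    by (rule P.minus_equality)
      (use assms in \<open>auto simp: RDirProd_def DirProd_def monoid.defs A.l_neg B.l_neg\<close>)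
qed

context morph_object
begin

lemma morph_End_subring:
  "subring (carrier (morph_End R M0 M1 \<mu>)) (RDirProd (rmod_End R M0) (rmod_End R M1))"
proof -
  interpret M0: right_module R M0 by (rule right_module_dom)
  interpret M1: right_module R M1 by (rule right_module_cod)
  interpret P: ring "RDirProd (rmod_End R M0) (rmod_End R M1)"
    by (rule RDirProd_ring[OF M0.rmod_End_ring M1.rmod_End_ring])
  have mem: "(u, v) \<in> carrier (morph_End R M0 M1 \<mu>) \<longleftrightarrow>
      u \<in> rmod_hom R M0 M0 \<and> v \<in> rmod_hom R M1 M1 \<and> (\<forall>x \<in> carrier M0. v (\<mu> x) = \<mu> (u x))" for u v
    by (auto simp: morph_End_def morph_hom_def compose_def restrict_def fun_eq_iff)
  note cl = rmod_hom_closed[OF hom]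
  show ?thesis
  proof (rule P.subringI)
    show "carrier (morph_End R M0 M1 \<mu>) \<subseteq> carrier (RDirProd (rmod_End R M0) (rmod_End R M1))"
      by (auto simp: mem RDirProd_carrier rmod_End_def)
    show "\<one>\<^bsub>RDirProd (rmod_End R M0) (rmod_End R M1)\<^esub> \<in> carrier (morph_End R M0 M1 \<mu>)"
      using cl by (auto simp: mem RDirProd_def DirProd_def monoid.defs rmod_End_def
          M0.rmod_End_closed M1.rmod_End_closed)
  next
    fix h assume "h \<in> carrier (morph_End R M0 M1 \<mu>)"
    then obtain u v where h: "h = (u, v)" "u \<in> rmod_hom R M0 M0" "v \<in> rmod_hom R M1 M1"
      "\<And>x. x \<in> carrier M0 \<Longrightarrow> v (\<mu> x) = \<mu> (u x)"
      using mem by (cases h) auto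
    have neg: "\<mu> (\<ominus>\<^bsub>M0\<^esub> x) = \<ominus>\<^bsub>M1\<^esub> \<mu> x" if "x \<in> carrier M0" for x
      using that rmod_hom_add[OF hom, of "\<ominus>\<^bsub>M0\<^esub> x" x]
        rmod_hom_zero[OF right_module_dom right_module_cod hom] cl
      by (simp add: M0.M.l_neg M1.M.minus_equality)
    have "\<ominus>\<^bsub>RDirProd (rmod_End R M0) (rmod_End R M1)\<^esub> h =
        (\<lambda>x \<in> carrier M0. \<ominus>\<^bsub>M0\<^esub> u x, \<lambda>x \<in> carrier M1. \<ominus>\<^bsub>M1\<^esub> v x)"
      using RDirProd_a_inv[OF M0.rmod_End_ring M1.rmod_End_ring, of u v] h
      by (simp add: M0.rmod_End_a_inv M1.rmod_End_a_inv) (simp add: rmod_End_def)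
    then show "\<ominus>\<^bsub>RDirProd (rmod_End R M0) (rmod_End R M1)\<^esub> h \<in> carrier (morph_End R M0 M1 \<mu>)"
      using h cl by (simp add: mem M0.rmod_End_neg M1.rmod_End_neg neg rmod_hom_closed)
  next
    fix h k assume "h \<in> carrier (morph_End R M0 M1 \<mu>)" "k \<in> carrier (morph_End R M0 M1 \<mu>)"
    then obtain u v u' v' where
      h: "h = (u, v)" "u \<in> rmod_hom R M0 M0" "v \<in> rmod_hom R M1 M1"
        "\<And>x. x \<in> carrier M0 \<Longrightarrow> v (\<mu> x) = \<mu> (u x)" and
      k: "k = (u', v')" "u' \<in> rmod_hom R M0 M0" "v' \<in> rmod_hom R M1 M1"
        "\<And>x. x \<in> carrier M0 \<Longrightarrow> v' (\<mu> x) = \<mu> (u' x)"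
      using mem by (cases h, cases k) auto
    show "h \<otimes>\<^bsub>RDirProd (rmod_End R M0) (rmod_End R M1)\<^esub> k \<in> carrier (morph_End R M0 M1 \<mu>)"
      using h k cl by (simp add: mem RDirProd_def DirProd_def monoid.defs rmod_End_def
          M0.rmod_End_closed M1.rmod_End_closed compose_eq rmod_hom_closed)
    show "h \<oplus>\<^bsub>RDirProd (rmod_End R M0) (rmod_End R M1)\<^esub> k \<in> carrier (morph_End R M0 M1 \<mu>)"
      using h k cl by (simp add: mem RDirProd_def DirProd_def monoid.defs rmod_End_def
          M0.rmod_End_closed M1.rmod_End_closed rmod_hom_closed rmod_hom_add[OF hom])
  qed
qed

lemma morph_End_ring: "ring (morph_End R M0 M1 \<mu>)"
proof -
  interpret P: ring "RDirProd (rmod_End R M0) (rmod_End R M1)"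
    by (rule RDirProd_ring[OF right_module.rmod_End_ring[OF right_module_dom]
          right_module.rmod_End_ring[OF right_module_cod]])
  show ?thesis
    using P.subring_is_ring[OF morph_End_subring] by (simp add: morph_End_def)
qed

lemma morph_End0_subring: "subring (carrier (morph_End0 R M0 M1 \<mu>)) (rmod_End R M0)"
  and morph_End1_subring: "subring (carrier (morph_End1 R M0 M1 \<mu>)) (rmod_End R M1)"
proof -
  interpret A: ring "rmod_End R M0" by (rule right_module.rmod_End_ring[OF right_module_dom])
  interpret B: ring "rmod_End R M1" by (rule right_module.rmod_End_ring[OF right_module_cod])
  have P: "ring (RDirProd (rmod_End R M0) (rmod_End R M1))"
    by (rule RDirProd_ring[OF A.ring_axioms B.ring_axioms])
  interpret p0: ring_hom_ring "RDirProd (rmod_End R M0) (rmod_End R M1)" "rmod_End R M0" fst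
    by (rule ring_hom_ringI2[OF P A.ring_axioms ring_hom_fst])
  interpret p1: ring_hom_ring "RDirProd (rmod_End R M0) (rmod_End R M1)" "rmod_End R M1" snd
    by (rule ring_hom_ringI2[OF P B.ring_axioms ring_hom_snd])
  show "subring (carrier (morph_End0 R M0 M1 \<mu>)) (rmod_End R M0)"
    using p0.img_is_subring[OF morph_End_subring] by (simp add: morph_End0_def)
  show "subring (carrier (morph_End1 R M0 M1 \<mu>)) (rmod_End R M1)"
    using p1.img_is_subring[OF morph_End_subring] by (simp add: morph_End1_def)
qed

lemma morph_End0_ring: "ring (morph_End0 R M0 M1 \<mu>)"
  using ring.subring_is_ring[OF right_module.rmod_End_ring[OF right_module_dom]
      morph_End0_subring] by (simp add: morph_End0_def)

lemma morph_End1_ring: "ring (morph_End1 R M0 M1 \<mu>)"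
  using ring.subring_is_ring[OF right_module.rmod_End_ring[OF right_module_cod]
      morph_End1_subring] by (simp add: morph_End1_def)

end

end

theory Submission
  imports Defs
begin

text \<open>Write \<open>E\<close> for the endomorphism ring of \<open>\<mu>\<close> and \<open>E0\<close>, \<open>E1\<close> for its images under the
  two projections. The proof works with units instead of maximal right ideals: a ring is local if and only if
  \<open>\<one> \<noteq> \<zero>\<close> and, for every \<open>x\<close>, one of \<open>x\<close> and \<open>\<one> \<ominus> x\<close> is a unit (\<open>local_ring_unit_or_unit\<close>
  and \<open>local_ringI\<close>).

  If \<open>M0\<close> or \<open>M1\<close> is zero, then \<open>\<mu> = 0\<close> imposes no condition on an endomorphism of the other
  module, so that \<open>E\<close> is isomorphic to the endomorphism ring of the latter
  (\<open>morph_End_iso_cod\<close>, \<open>morph_End_iso_dom\<close>).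

  If both modules are nonzero, then so are \<open>E0\<close> and \<open>E1\<close>. A surjective homomorphism from a local
  ring onto a nonzero ring has a local image and reflects units (\<open>local_ring_image\<close>,
  \<open>local_ring_Units_iff\<close>). If \<open>E\<close> is local, this applies to both projections: \<open>E0\<close> is local,
  and \<open>u0\<close> is a unit of \<open>E0\<close> exactly when \<open>(u0, u1)\<close> is a unit of \<open>E\<close>, that is, exactly when
  \<open>u1\<close> is a unit of \<open>E1\<close>. For the converse the link is that a pair of
  units is a unit of \<open>E\<close> (\<open>Units_morph_EndI\<close>): whichever of \<open>u0\<close> and \<open>\<one> \<ominus> u0\<close> is invertible,
  the corresponding \<open>u1\<close> or \<open>\<one> \<ominus> u1\<close> is invertible with it, and so is the pair.\<close>

section \<open>Local rings in terms of units\<close>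

lemma (in monoid) Units_if_products_Units:
  assumes "x \<in> carrier G" "y \<in> carrier G" "x \<otimes> y \<in> Units G" "y \<otimes> x \<in> Units G"
  shows "x \<in> Units G"
proof -
  have r: "x \<otimes> (y \<otimes> inv (x \<otimes> y)) = \<one>" and l: "(inv (y \<otimes> x) \<otimes> y) \<otimes> x = \<one>"
    using assms by (simp_all add: m_assoc[symmetric]) (simp add: m_assoc)
  have yl: "inv (y \<otimes> x) \<otimes> y \<in> carrier G" and yr: "y \<otimes> inv (x \<otimes> y) \<in> carrier G"
    using assms by simp_all
  have "inv (y \<otimes> x) \<otimes> y = y \<otimes> inv (x \<otimes> y)"
    using inv_unique[OF l r assms(1) yl yr] .
  then show ?thesis
    unfolding Units_def using r l yl assms(1) by (metis (mono_tags, lifting) mem_Collect_eq)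
qed

context ring
begin

lemma right_idealI:
  assumes sub: "I \<subseteq> carrier R" and zero: "\<zero> \<in> I"
    and add: "\<And>a b. \<lbrakk>a \<in> I; b \<in> I\<rbrakk> \<Longrightarrow> a \<oplus> b \<in> I"
    and mult: "\<And>a x. \<lbrakk>a \<in> I; x \<in> carrier R\<rbrakk> \<Longrightarrow> a \<otimes> x \<in> I"
  shows "right_ideal I R"
proof -
  have neg: "\<ominus> a \<in> I" if "a \<in> I" for a
    using mult[OF that, of "\<ominus> \<one>"] sub that by (auto simp: r_minus)
  have "subgroup I (add_monoid R)"
    by (rule add.subgroupI) (use assms neg in \<open>auto simp: a_inv_def[symmetric]\<close>)
  then show ?thesis
    by (intro right_ideal.intro additive_subgroup.intro right_ideal_axioms.intro ring_axioms mult)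
qed

lemma right_ideal_eq_carrier_iff:
  assumes "right_ideal I R"
  shows "I = carrier R \<longleftrightarrow> \<one> \<in> I"
proof -
  interpret right_ideal I R by fact
  show ?thesis using I_r_closed[of \<one>] a_subset by auto
qed

lemma right_ideal_principal:
  assumes a: "a \<in> carrier R"
  shows "right_ideal ((\<lambda>x. a \<otimes> x) ` carrier R) R"
proof (rule right_idealI)
  show "\<zero> \<in> (\<lambda>x. a \<otimes> x) ` carrier R"
    by (rule image_eqI[of _ _ \<zero>]) (use a in auto)
next
  fix b c assume "b \<in> (\<lambda>x. a \<otimes> x) ` carrier R" "c \<in> (\<lambda>x. a \<otimes> x) ` carrier R"
  then obtain x y where "b = a \<otimes> x" "c = a \<otimes> y" "x \<in> carrier R" "y \<in> carrier R" by auto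
  then show "b \<oplus> c \<in> (\<lambda>x. a \<otimes> x) ` carrier R"
    using a by (intro image_eqI[of _ _ "x \<oplus> y"]) (auto simp: r_distr)
next
  fix b y assume "b \<in> (\<lambda>x. a \<otimes> x) ` carrier R" "y \<in> carrier R"
  then show "b \<otimes> y \<in> (\<lambda>x. a \<otimes> x) ` carrier R"
    using a by (auto simp: m_assoc)
qed (use a in auto)

text \<open>Properness of a right ideal means \<open>\<one> \<notin> I\<close>, a condition that survives unions of chains;
  hence Zorn's lemma applies.\<close>

lemma proper_right_ideal_le_maximal:
  assumes I: "right_ideal I R" and proper: "\<one> \<notin> I"
  obtains J where "maximal_right_ideal J R" "I \<subseteq> J"
proof -
  let ?P = "{J. right_ideal J R \<and> I \<subseteq> J \<and> \<one> \<notin> J}"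
  have "\<exists>J\<in>?P. \<forall>K\<in>?P. J \<subseteq> K \<longrightarrow> K = J"
  proof (rule subset_Zorn_nonempty)
    show "?P \<noteq> {}" using assms by auto
  next
    fix C assume ne: "C \<noteq> {}" and C: "subset.chain ?P C"
    have ri: "right_ideal J R" and mem: "I \<subseteq> J" "\<one> \<notin> J" if "J \<in> C" for J
      using C that by (auto simp: subset.chain_def)
    note sub = additive_subgroup.a_subset[OF right_ideal.axioms(1)[OF ri]]
    have "right_ideal (\<Union>C) R"
    proof (rule right_idealI)
      show "\<Union>C \<subseteq> carrier R" using sub by blast
      show "\<zero> \<in> \<Union>C"
        using ne additive_subgroup.zero_closed[OF right_ideal.axioms(1)[OF ri]] by blast
    next
      fix a b assume "a \<in> \<Union>C" "b \<in> \<Union>C"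
      then obtain J K where JK: "J \<in> C" "K \<in> C" "a \<in> J" "b \<in> K" by blast
      then have "J \<subseteq> K \<or> K \<subseteq> J" using C by (auto simp: subset.chain_def)
      then obtain L where L: "L \<in> C" "a \<in> L" "b \<in> L" using JK by blast
      then show "a \<oplus> b \<in> \<Union>C"
        using additive_subgroup.a_closed[OF right_ideal.axioms(1)[OF ri]] by blast
    next
      fix a x assume "a \<in> \<Union>C" "x \<in> carrier R"
      then show "a \<otimes> x \<in> \<Union>C" using right_ideal.I_r_closed[OF ri] by blast
    qed
    then show "\<Union>C \<in> ?P" using ne mem by blast
  qed
  then obtain J where J: "right_ideal J R" "I \<subseteq> J" "\<one> \<notin> J"
    and max: "\<And>K. \<lbrakk>right_ideal K R; I \<subseteq> K; \<one> \<notin> K; J \<subseteq> K\<rbrakk> \<Longrightarrow> K = J" by auto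
  have "maximal_right_ideal J R"
  proof (intro maximal_right_ideal.intro maximal_right_ideal_axioms.intro J(1))
    show "carrier R \<noteq> J" using J(3) by auto
    fix K assume "right_ideal K R" "J \<subseteq> K"
    then show "K = J \<or> K = carrier R"
      using max[of K] J(2) right_ideal_eq_carrier_iff[of K] by blast
  qed
  then show thesis using J(2) that by blast
qed

text \<open>If \<open>J\<close> is the only maximal right ideal, then an element outside \<open>J\<close> generates a right ideal
  contained in no maximal one, so it is right invertible. Its right inverse \<open>y\<close> is again outside
  \<open>J\<close>: otherwise \<open>y \<otimes> x \<in> J\<close>, so that \<open>\<one> \<ominus> y \<otimes> x\<close> is right invertible, although \<open>x\<close>
  annihilates it from the left. Two successive right inverses make \<open>x\<close> a unit.\<close>

lemma local_ring_unit_or_unit: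
  assumes "local_ring R"
  shows "\<one> \<noteq> \<zero>" and "x \<in> carrier R \<Longrightarrow> x \<in> Units R \<or> \<one> \<ominus> x \<in> Units R"
proof -
  obtain J where J: "maximal_right_ideal J R" and uniq: "\<And>K. maximal_right_ideal K R \<Longrightarrow> K = J"
    using local_ring.unique_maximal_right_ideal[OF assms] by blast
  interpret J: maximal_right_ideal J R by (rule J)
  have one: "\<one> \<notin> J"
    using right_ideal_eq_carrier_iff[OF J.right_ideal_axioms] J.I_notcarr by blast
  then show nz: "\<one> \<noteq> \<zero>" using J.zero_closed by metis
  have rinv: "\<exists>y\<in>carrier R. z \<otimes> y = \<one>" if z: "z \<in> carrier R" "z \<notin> J" for z
  proof (rule ccontr)
    assume "\<not> ?thesis"
    then have "\<one> \<notin> (\<lambda>y. z \<otimes> y) ` carrier R" by force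
    then obtain K where "maximal_right_ideal K R" "(\<lambda>y. z \<otimes> y) ` carrier R \<subseteq> K"
      using proper_right_ideal_le_maximal[OF right_ideal_principal[OF z(1)]] by blast
    then have "z \<otimes> \<one> \<in> J" using uniq by blast
    then show False using z by simp
  qed
  have compl: "\<one> \<ominus> z \<notin> J" if "z \<in> J" for z
  proof
    assume "\<one> \<ominus> z \<in> J"
    then have "(\<one> \<ominus> z) \<oplus> z \<in> J" using that by simp
    moreover have "(\<one> \<ominus> z) \<oplus> z = \<one>"
      using J.a_Hcarr[OF that] by (simp add: a_minus_def a_assoc l_neg)
    ultimately show False using one by simp
  qed
  have unit: "z \<in> Units R" if z: "z \<in> carrier R" "z \<notin> J" for z
  proof -
    obtain y where y: "y \<in> carrier R" "z \<otimes> y = \<one>" using rinv[OF z] by blast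
    have "y \<notin> J"
    proof
      assume "y \<in> J"
      then have "\<one> \<ominus> y \<otimes> z \<notin> J" using compl J.I_r_closed z by blast
      then obtain w where w: "w \<in> carrier R" "(\<one> \<ominus> y \<otimes> z) \<otimes> w = \<one>"
        using rinv[of "\<one> \<ominus> y \<otimes> z"] y z by auto
      have "z \<otimes> (\<one> \<ominus> y \<otimes> z) = \<zero>"
        using y z by (simp add: a_minus_def r_distr r_minus m_assoc[symmetric] r_neg)
      then have "z \<otimes> ((\<one> \<ominus> y \<otimes> z) \<otimes> w) = \<zero>"
        using y z w(1) by (simp add: m_assoc[symmetric])
      then have "z = \<zero>" using w z by simp
      then show False using y nz by simp
    qed
    then obtain w where w: "w \<in> carrier R" "y \<otimes> w = \<one>" using rinv y by blast
    then have "z = w" using inv_unique[of z y w] y z by simp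
    then show ?thesis using w y z by (auto simp: Units_def)
  qed
  show "x \<in> Units R \<or> \<one> \<ominus> x \<in> Units R" if "x \<in> carrier R"
    using unit[of x] unit[of "\<one> \<ominus> x"] compl[of x] that by auto
qed

text \<open>Conversely the nonunits form a right ideal, which contains every proper right ideal.
  One-sided inverses are two-sided here, because \<open>\<zero>\<close> and \<open>\<one>\<close> are the only idempotents;
  this makes the nonunits absorb multiplication on the right. They are closed under addition
  because a unit \<open>x \<oplus> y\<close> can be normalised to \<open>\<one>\<close> by right multiplication with its inverse, and then
  \<open>y = \<one> \<ominus> x\<close>.\<close>

lemma local_ringI:
  assumes nz: "\<one> \<noteq> \<zero>"
    and alt: "\<And>x. x \<in> carrier R \<Longrightarrow> x \<in> Units R \<or> \<one> \<ominus> x \<in> Units R"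
  shows "local_ring R"
proof -
  let ?J = "carrier R - Units R"
  have right_inv: "x \<in> Units R" if xy: "x \<in> carrier R" "y \<in> carrier R" "x \<otimes> y = \<one>" for x y
  proof -
    let ?e = "y \<otimes> x"
    have x_e: "x \<otimes> (\<one> \<ominus> ?e) = \<zero>"
      using xy by (simp add: a_minus_def r_distr r_minus m_assoc[symmetric] r_neg)
    have e_y: "(\<one> \<ominus> ?e) \<otimes> y = \<zero>"
      using xy by (simp add: a_minus_def l_distr l_minus m_assoc r_neg)
    from alt[of ?e] xy have "?e \<in> Units R \<or> \<one> \<ominus> ?e \<in> Units R" by simp
    then have "?e \<in> Units R"
    proof
      \<comment> \<open>a unit cannot annihilate \<open>y\<close>, since \<open>x \<otimes> y = \<one>\<close>\<close>
      assume u: "\<one> \<ominus> ?e \<in> Units R"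
      then have "y = inv (\<one> \<ominus> ?e) \<otimes> ((\<one> \<ominus> ?e) \<otimes> y)"
        using xy by (simp add: m_assoc[symmetric])
      then have "y = \<zero>" using e_y u by simp
      then show ?thesis using xy nz by simp
    qed
    then have "\<one> \<ominus> ?e = inv ?e \<otimes> (?e \<otimes> (\<one> \<ominus> ?e))"
      using xy m_assoc[of "inv ?e" ?e "\<one> \<ominus> ?e"] by simp
    also have "?e \<otimes> (\<one> \<ominus> ?e) = \<zero>" using xy x_e by (simp add: m_assoc)
    finally have "\<one> \<ominus> ?e = \<zero>" using \<open>?e \<in> Units R\<close> by simp
    then have "?e = \<one>" using xy r_right_minus_eq[of \<one> ?e] by simp
    then show ?thesis using xy by (auto simp: Units_def)
  qed
  have unit_mult: "x \<in> Units R" if "x \<otimes> y \<in> Units R" "x \<in> carrier R" "y \<in> carrier R" for x y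
    by (rule right_inv[of _ "y \<otimes> inv (x \<otimes> y)"])
      (use that in \<open>auto simp: m_assoc[symmetric]\<close>)
  have J: "right_ideal ?J R"
  proof (rule right_idealI)
    show "\<zero> \<in> ?J" using nz by (auto simp: Units_def)
  next
    fix x y assume xy: "x \<in> ?J" "y \<in> ?J"
    have False if u: "x \<oplus> y \<in> Units R"
    proof -
      let ?v = "inv (x \<oplus> y)"
      have "x \<otimes> ?v \<oplus> y \<otimes> ?v = \<one>" using xy u by (simp add: l_distr[symmetric])
      moreover have "(x \<otimes> ?v \<oplus> y \<otimes> ?v) \<ominus> x \<otimes> ?v = y \<otimes> ?v"
        using xy u by (simp add: minus_eq a_comm[of "x \<otimes> ?v" "y \<otimes> ?v"] a_assoc r_neg)
      ultimately have "\<one> \<ominus> x \<otimes> ?v = y \<otimes> ?v" by simp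
      then have "x \<otimes> ?v \<in> Units R \<or> y \<otimes> ?v \<in> Units R"
        using alt[of "x \<otimes> ?v"] xy u by auto
      then show False
        using unit_mult[of x ?v] unit_mult[of y ?v] xy u by blast
    qed
    then show "x \<oplus> y \<in> ?J" using xy by auto
  next
    fix x r assume "x \<in> ?J" "r \<in> carrier R"
    then show "x \<otimes> r \<in> ?J" using unit_mult[of x r] by blast
  qed auto
  have le: "K \<subseteq> ?J" if K: "right_ideal K R" "carrier R \<noteq> K" for K
  proof
    interpret K: right_ideal K R by (rule K)
    fix x assume x: "x \<in> K"
    have "x \<notin> Units R"
    proof
      assume "x \<in> Units R"
      then have "\<one> \<in> K" using K.I_r_closed[OF x, of "inv x"] by simp
      then show False using K right_ideal_eq_carrier_iff by blast
    qed
    then show "x \<in> ?J" using K.a_Hcarr[OF x] by simp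
  qed
  have "maximal_right_ideal ?J R"
    by (intro maximal_right_ideal.intro maximal_right_ideal_axioms.intro J) (use le in auto)
  moreover have "K = ?J" if "maximal_right_ideal K R" for K
  proof -
    interpret K: maximal_right_ideal K R by (rule that)
    show ?thesis
      using K.I_maximal[OF J] le[OF K.right_ideal_axioms K.I_notcarr] by auto
  qed
  ultimately show ?thesis
    by (intro local_ring.intro local_ring_axioms.intro ring_axioms) blast
qed

end

section \<open>Local rings and surjective homomorphisms\<close>

context ring_hom_ring
begin

lemma hom_Units:
  assumes "x \<in> Units R"
  shows "h x \<in> Units S"
proof -
  have "h (inv x) \<otimes>\<^bsub>S\<^esub> h x = \<one>\<^bsub>S\<^esub>" "h x \<otimes>\<^bsub>S\<^esub> h (inv x) = \<one>\<^bsub>S\<^esub>"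
    using assms hom_mult[of "inv x" x] hom_mult[of x "inv x"] by (simp_all add: R.Units_closed)
  then show ?thesis using assms by (auto simp: Units_def[of S] intro!: bexI[of _ "h (inv x)"])
qed

lemma hom_one_minus: "x \<in> carrier R \<Longrightarrow> h (\<one> \<ominus> x) = \<one>\<^bsub>S\<^esub> \<ominus>\<^bsub>S\<^esub> h x"
  by (simp add: a_minus_def)

lemma local_ring_image:
  assumes "local_ring R" "h ` carrier R = carrier S" "\<one>\<^bsub>S\<^esub> \<noteq> \<zero>\<^bsub>S\<^esub>"
  shows "local_ring S"
proof (rule S.local_ringI)
  fix y assume "y \<in> carrier S"
  then obtain x where "x \<in> carrier R" "y = h x" using assms(2) by blast
  then show "y \<in> Units S \<or> \<one>\<^bsub>S\<^esub> \<ominus>\<^bsub>S\<^esub> y \<in> Units S"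
    using R.local_ring_unit_or_unit(2)[OF assms(1)] hom_Units hom_one_minus by metis
qed fact

text \<open>If \<open>h x \<otimes> h y = \<one>\<close>, then \<open>h\<close> kills \<open>\<one> \<ominus> x \<otimes> y\<close>, which is therefore not a unit;
  locality of \<open>R\<close> makes \<open>x \<otimes> y\<close> a unit, and likewise \<open>y \<otimes> x\<close>.\<close>

lemma local_ring_Units_iff:
  assumes loc: "local_ring R" and surj: "h ` carrier R = carrier S" and nz: "\<one>\<^bsub>S\<^esub> \<noteq> \<zero>\<^bsub>S\<^esub>"
    and x: "x \<in> carrier R"
  shows "h x \<in> Units S \<longleftrightarrow> x \<in> Units R"
proof
  have lift: "a \<in> Units R" if "a \<in> carrier R" "h a = \<one>\<^bsub>S\<^esub>" for a
  proof -
    have "h (\<one> \<ominus> a) = \<zero>\<^bsub>S\<^esub>" using that by (simp add: hom_one_minus)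
    then have "\<one> \<ominus> a \<notin> Units R"
      using hom_Units[of "\<one> \<ominus> a"] nz by (auto simp: Units_def)
    then show ?thesis using R.local_ring_unit_or_unit(2)[OF loc that(1)] by simp
  qed
  assume hx: "h x \<in> Units S"
  then obtain y where y: "y \<in> carrier R" "h y = inv\<^bsub>S\<^esub> h x"
    using surj S.Units_inv_closed by (metis imageE)
  have "x \<otimes> y \<in> Units R" "y \<otimes> x \<in> Units R"
    using lift[of "x \<otimes> y"] lift[of "y \<otimes> x"] x y hx by auto
  then show "x \<in> Units R"
    using R.Units_if_products_Units x y by blast
qed (rule hom_Units)

end

lemma local_ring_iso_imp:
  assumes "ring A" "ring B" "h \<in> ring_iso A B" and loc: "local_ring A"
  shows "local_ring B"
proof -
  interpret ring_hom_ring A B h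
    using assms by (intro ring_hom_ringI2) (auto simp: ring_iso_def)
  have bij: "bij_betw h (carrier A) (carrier B)" using assms(3) by (simp add: ring_iso_def)
  have "h \<one>\<^bsub>A\<^esub> \<noteq> h \<zero>\<^bsub>A\<^esub>"
    using R.local_ring_unit_or_unit(1)[OF loc] bij_betw_imp_inj_on[OF bij]
    by (metis inj_onD R.one_closed R.zero_closed)
  then show ?thesis
    using local_ring_image[OF loc] bij by (simp add: bij_betw_def)
qed

lemma local_ring_iso:
  assumes "ring A" "ring B" "h \<in> ring_iso A B"
  shows "local_ring A \<longleftrightarrow> local_ring B"
  using local_ring_iso_imp[OF assms] local_ring_iso_imp[OF assms(2,1) ring_iso_set_sym[OF assms(1,3)]]
  by blast

section \<open>Endomorphisms of a module homomorphism\<close>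

lemma (in right_module) rmod_End_one_eq_zero_iff:
  "\<one>\<^bsub>rmod_End R M\<^esub> = \<zero>\<^bsub>rmod_End R M\<^esub> \<longleftrightarrow> carrier M = {\<zero>\<^bsub>M\<^esub>}"
proof
  assume "\<one>\<^bsub>rmod_End R M\<^esub> = \<zero>\<^bsub>rmod_End R M\<^esub>"
  then have "x = \<zero>\<^bsub>M\<^esub>" if "x \<in> carrier M" for x
    using that by (auto simp: rmod_End_def restrict_def fun_eq_iff split: if_splits)
  then show "carrier M = {\<zero>\<^bsub>M\<^esub>}" by auto
qed (auto simp: rmod_End_def restrict_def fun_eq_iff)

lemma rmod_hom_from_zero_unique:
  assumes "right_module R M" "right_module R N" "carrier M = {\<zero>\<^bsub>M\<^esub>}"
    and "f \<in> rmod_hom R M N" "g \<in> rmod_hom R M N"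
  shows "f = g"
  using rmod_hom_zero[OF assms(1,2,4)] rmod_hom_zero[OF assms(1,2,5)] assms(3)
  by (intro rmod_hom_eqI[OF assms(4,5)]) simp

context morph_object
begin

sublocale M0: right_module R M0 by (rule right_module_dom)
sublocale M1: right_module R M1 by (rule right_module_cod)

abbreviation "E \<equiv> morph_End R M0 M1 \<mu>"
abbreviation "E0 \<equiv> morph_End0 R M0 M1 \<mu>"
abbreviation "E1 \<equiv> morph_End1 R M0 M1 \<mu>"

lemma mem_morph_End_iff:
  "(u, v) \<in> carrier E \<longleftrightarrow>
    u \<in> rmod_hom R M0 M0 \<and> v \<in> rmod_hom R M1 M1 \<and> (\<forall>x \<in> carrier M0. v (\<mu> x) = \<mu> (u x))"
  by (auto simp: morph_End_def morph_hom_def compose_def restrict_def fun_eq_iff)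

lemma morph_End_ops:
  "(u, v) \<otimes>\<^bsub>E\<^esub> (u', v') = (compose (carrier M0) u u', compose (carrier M1) v v')"
  "\<one>\<^bsub>E\<^esub> = (\<lambda>x \<in> carrier M0. x, \<lambda>x \<in> carrier M1. x)"
  by (simp_all add: morph_End_def RDirProd_def DirProd_def monoid.defs rmod_End_def)

lemma fst_morph_End: "fst \<in> ring_hom E (rmod_End R M0)"
  and snd_morph_End: "snd \<in> ring_hom E (rmod_End R M1)"
  by (auto simp: ring_hom_def mem_morph_End_iff)
    (auto simp: morph_End_def RDirProd_def DirProd_def monoid.defs rmod_End_def)

lemma fst_morph_End0: "ring_hom_ring E E0 fst"
  by (rule ring_hom_ringI2[OF morph_End_ring morph_End0_ring])
    (use fst_morph_End in \<open>auto simp: ring_hom_def morph_End0_def\<close>)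

lemma snd_morph_End1: "ring_hom_ring E E1 snd"
  by (rule ring_hom_ringI2[OF morph_End_ring morph_End1_ring])
    (use snd_morph_End in \<open>auto simp: ring_hom_def morph_End1_def\<close>)

lemma fst_image_morph_End: "fst ` carrier E = carrier E0"
  and snd_image_morph_End: "snd ` carrier E = carrier E1"
  by (simp_all add: morph_End0_def morph_End1_def)

lemma morph_End0_one_eq_zero_iff: "\<one>\<^bsub>E0\<^esub> = \<zero>\<^bsub>E0\<^esub> \<longleftrightarrow> carrier M0 = {\<zero>\<^bsub>M0\<^esub>}"
  and morph_End1_one_eq_zero_iff: "\<one>\<^bsub>E1\<^esub> = \<zero>\<^bsub>E1\<^esub> \<longleftrightarrow> carrier M1 = {\<zero>\<^bsub>M1\<^esub>}"
  using M0.rmod_End_one_eq_zero_iff M1.rmod_End_one_eq_zero_iff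
  by (simp_all add: morph_End0_def morph_End1_def)

text \<open>The inverses of \<open>u\<close> and \<open>v\<close> come as components of two possibly different elements of
  \<open>E\<close>, but they are themselves the components of one element: inverting \<open>u\<close> and \<open>v\<close> in
  \<open>v \<circ> \<mu> = \<mu> \<circ> u\<close> gives \<open>\<mu> \<circ> u\<^sup>-\<^sup>1 = v\<^sup>-\<^sup>1 \<circ> \<mu>\<close>.\<close>

lemma Units_morph_EndI:
  assumes uv: "(u, v) \<in> carrier E" and u: "u \<in> Units E0" and v: "v \<in> Units E1"
  shows "(u, v) \<in> Units E"
proof -
  obtain u' where u': "u' \<in> rmod_hom R M0 M0"
      "compose (carrier M0) u' u = (\<lambda>x \<in> carrier M0. x)"
      "compose (carrier M0) u u' = (\<lambda>x \<in> carrier M0. x)"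
    using u by (auto simp: Units_def morph_End0_def rmod_End_def mem_morph_End_iff)
  obtain v' where v': "v' \<in> rmod_hom R M1 M1"
      "compose (carrier M1) v' v = (\<lambda>x \<in> carrier M1. x)"
      "compose (carrier M1) v v' = (\<lambda>x \<in> carrier M1. x)"
    using v by (auto simp: Units_def morph_End1_def rmod_End_def mem_morph_End_iff)
  have "v' (\<mu> x) = \<mu> (u' x)" if x: "x \<in> carrier M0" for x
  proof -
    have u'x: "u' x \<in> carrier M0" using u'(1) x by (rule rmod_hom_closed)
    have "v' (\<mu> x) = v' (\<mu> (u (u' x)))"
      using fun_cong[OF u'(3), of x] x by (simp add: compose_eq)
    also have "\<dots> = v' (v (\<mu> (u' x)))" using uv u'x by (simp add: mem_morph_End_iff)
    also have "\<dots> = \<mu> (u' x)"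
      using fun_cong[OF v'(2), of "\<mu> (u' x)"] rmod_hom_closed[OF hom u'x] by (simp add: compose_eq)
    finally show ?thesis .
  qed
  then have "(u', v') \<in> carrier E" using u' v' by (simp add: mem_morph_End_iff)
  then show ?thesis
    using uv u' v' by (auto simp: Units_def morph_End_ops intro!: bexI[of _ "(u', v')"])
qed

text \<open>The first component of an element of \<open>E\<close> is zero, and \<open>\<mu> = 0\<close> commutes with every second
  component.\<close>

lemma morph_End_iso_cod:
  assumes "carrier M0 = {\<zero>\<^bsub>M0\<^esub>}"
  shows "snd \<in> ring_iso E (rmod_End R M1)"
proof -
  have "u = u'" if "u \<in> rmod_hom R M0 M0" "u' \<in> rmod_hom R M0 M0" for u u'
    using rmod_hom_from_zero_unique[OF right_module_dom right_module_dom assms that] .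
  then have inj: "inj_on snd (carrier E)"
    by (auto simp: inj_on_def mem_morph_End_iff)
  have zero_pair: "(\<lambda>x \<in> carrier M0. \<zero>\<^bsub>M0\<^esub>, v) \<in> carrier E" if "v \<in> rmod_hom R M1 M1" for v
    using that assms rmod_hom_zero[OF right_module_dom right_module_cod hom]
      rmod_hom_zero[OF right_module_cod right_module_cod that] M0.rmod_End_zero_closed
    by (simp add: mem_morph_End_iff)
  have "snd ` carrier E = carrier (rmod_End R M1)"
  proof
    show "snd ` carrier E \<subseteq> carrier (rmod_End R M1)"
      by (auto simp: rmod_End_def mem_morph_End_iff)
    show "carrier (rmod_End R M1) \<subseteq> snd ` carrier E"
    proof
      fix v assume "v \<in> carrier (rmod_End R M1)"
      then have "(\<lambda>x \<in> carrier M0. \<zero>\<^bsub>M0\<^esub>, v) \<in> carrier E"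
        using zero_pair by (simp add: rmod_End_def)
      then show "v \<in> snd ` carrier E" by (rule rev_image_eqI) simp
    qed
  qed
  then show ?thesis
    using inj snd_morph_End by (simp add: ring_iso_def bij_betw_def)
qed

lemma morph_End_iso_dom:
  assumes "carrier M1 = {\<zero>\<^bsub>M1\<^esub>}"
  shows "fst \<in> ring_iso E (rmod_End R M0)"
proof -
  have "v = v'" if "v \<in> rmod_hom R M1 M1" "v' \<in> rmod_hom R M1 M1" for v v'
    using rmod_hom_from_zero_unique[OF right_module_cod right_module_cod assms that] .
  then have inj: "inj_on fst (carrier E)"
    by (auto simp: inj_on_def mem_morph_End_iff)
  have zero_pair: "(u, \<lambda>x \<in> carrier M1. \<zero>\<^bsub>M1\<^esub>) \<in> carrier E" if "u \<in> rmod_hom R M0 M0" for u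
    using that assms rmod_hom_closed[OF hom] rmod_hom_closed[OF that] M1.rmod_End_zero_closed
    by (auto simp: mem_morph_End_iff)
  have "fst ` carrier E = carrier (rmod_End R M0)"
  proof
    show "fst ` carrier E \<subseteq> carrier (rmod_End R M0)"
      by (auto simp: rmod_End_def mem_morph_End_iff)
    show "carrier (rmod_End R M0) \<subseteq> fst ` carrier E"
    proof
      fix u assume "u \<in> carrier (rmod_End R M0)"
      then have "(u, \<lambda>x \<in> carrier M1. \<zero>\<^bsub>M1\<^esub>) \<in> carrier E"
        using zero_pair by (simp add: rmod_End_def)
      then show "u \<in> fst ` carrier E" by (rule rev_image_eqI) simp
    qed
  qed
  then show ?thesis
    using inj fst_morph_End by (simp add: ring_iso_def bij_betw_def)
qed

text \<open>Locality makes both projections onto nonzero rings reflect units, so that invertibility of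
  \<open>u\<close> in \<open>E0\<close>, of \<open>v\<close> in \<open>E1\<close> and of \<open>(u, v)\<close> in \<open>E\<close> all coincide.\<close>

lemma local_morph_End_iff:
  assumes M0: "carrier M0 \<noteq> {\<zero>\<^bsub>M0\<^esub>}" and M1: "carrier M1 \<noteq> {\<zero>\<^bsub>M1\<^esub>}"
  shows "local_ring E \<longleftrightarrow>
    (\<forall>(u, v) \<in> carrier E.
      (u \<in> Units E0 \<or> \<one>\<^bsub>E0\<^esub> \<ominus>\<^bsub>E0\<^esub> u \<in> Units E0) \<and> (u \<in> Units E0 \<longleftrightarrow> v \<in> Units E1))"
    (is "_ \<longleftrightarrow> ?units")
proof -
  interpret p0: ring_hom_ring E E0 fst by (rule fst_morph_End0)
  interpret p1: ring_hom_ring E E1 snd by (rule snd_morph_End1)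
  have nz0: "\<one>\<^bsub>E0\<^esub> \<noteq> \<zero>\<^bsub>E0\<^esub>" and nz1: "\<one>\<^bsub>E1\<^esub> \<noteq> \<zero>\<^bsub>E1\<^esub>"
    using M0 M1 by (simp_all add: morph_End0_one_eq_zero_iff morph_End1_one_eq_zero_iff)
  show ?thesis
  proof
    assume loc: "local_ring E"
    have "local_ring E0"
      using loc fst_image_morph_End nz0 by (rule p0.local_ring_image)
    then have "u \<in> Units E0 \<or> \<one>\<^bsub>E0\<^esub> \<ominus>\<^bsub>E0\<^esub> u \<in> Units E0" if "(u, v) \<in> carrier E" for u v
      using p0.S.local_ring_unit_or_unit(2) p0.hom_closed[OF that] by simp
    moreover have "u \<in> Units E0 \<longleftrightarrow> v \<in> Units E1" if "(u, v) \<in> carrier E" for u v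
      using p0.local_ring_Units_iff[OF loc fst_image_morph_End nz0 that]
        p1.local_ring_Units_iff[OF loc snd_image_morph_End nz1 that] by simp
    ultimately show ?units by blast
  next
    assume units: ?units
    have reflect: "w \<in> Units E" if "w \<in> carrier E" "fst w \<in> Units E0" for w
      using that units Units_morph_EndI[of "fst w" "snd w"] by (cases w) auto
    show "local_ring E"
    proof (rule p0.R.local_ringI)
      show "\<one>\<^bsub>E\<^esub> \<noteq> \<zero>\<^bsub>E\<^esub>" using nz0 p0.hom_one p0.hom_zero by metis
      fix w assume w: "w \<in> carrier E"
      then have "fst w \<in> Units E0 \<or> fst (\<one>\<^bsub>E\<^esub> \<ominus>\<^bsub>E\<^esub> w) \<in> Units E0"
        using units by (auto simp: p0.hom_one_minus)
      then show "w \<in> Units E \<or> \<one>\<^bsub>E\<^esub> \<ominus>\<^bsub>E\<^esub> w \<in> Units E"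
        using reflect w by blast
    qed
  qed
qed

end

theorem theorem5p3:
  fixes R :: "('a, 'm) ring_scheme"
    and M0 :: "('a, 'b, 'n) right_module_scheme"
    and M1 :: "('a, 'c, 'k) right_module_scheme"
    and \<mu> :: "'b \<Rightarrow> 'c"
  assumes "morph_object R M0 M1 \<mu>"
  shows "local_ring (morph_End R M0 M1 \<mu>) \<longleftrightarrow>
    (carrier M0 = {\<zero>\<^bsub>M0\<^esub>} \<and> local_ring (rmod_End R M1)) \<or>
    (carrier M1 = {\<zero>\<^bsub>M1\<^esub>} \<and> local_ring (rmod_End R M0)) \<or>
    (carrier M0 \<noteq> {\<zero>\<^bsub>M0\<^esub>} \<and> carrier M1 \<noteq> {\<zero>\<^bsub>M1\<^esub>} \<and>
      (\<forall>(u0, u1) \<in> carrier (morph_End R M0 M1 \<mu>).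
        (u0 \<in> Units (morph_End0 R M0 M1 \<mu>) \<or>
          \<one>\<^bsub>morph_End0 R M0 M1 \<mu>\<^esub> \<ominus>\<^bsub>morph_End0 R M0 M1 \<mu>\<^esub> u0 \<in> Units (morph_End0 R M0 M1 \<mu>)) \<and>
        (u0 \<in> Units (morph_End0 R M0 M1 \<mu>) \<longleftrightarrow> u1 \<in> Units (morph_End1 R M0 M1 \<mu>))))"
proof -
  interpret morph_object R M0 M1 \<mu> by fact
  have not_local0: "\<not> local_ring (rmod_End R M0)" if "carrier M0 = {\<zero>\<^bsub>M0\<^esub>}"
    using ring.local_ring_unit_or_unit(1)[OF M0.rmod_End_ring] M0.rmod_End_one_eq_zero_iff that
    by blast
  have not_local1: "\<not> local_ring (rmod_End R M1)" if "carrier M1 = {\<zero>\<^bsub>M1\<^esub>}"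
    using ring.local_ring_unit_or_unit(1)[OF M1.rmod_End_ring] M1.rmod_End_one_eq_zero_iff that
    by blast
  consider "carrier M0 = {\<zero>\<^bsub>M0\<^esub>}" | "carrier M0 \<noteq> {\<zero>\<^bsub>M0\<^esub>}" "carrier M1 = {\<zero>\<^bsub>M1\<^esub>}"
    | "carrier M0 \<noteq> {\<zero>\<^bsub>M0\<^esub>}" "carrier M1 \<noteq> {\<zero>\<^bsub>M1\<^esub>}" by blast
  then show ?thesis
  proof cases
    case 1
    then show ?thesis
      using local_ring_iso[OF morph_End_ring M1.rmod_End_ring morph_End_iso_cod] not_local0 by simp
  next
    case 2
    then show ?thesis
      using local_ring_iso[OF morph_End_ring M0.rmod_End_ring morph_End_iso_dom] by simp
  next
    case 3
    then show ?thesis using local_morph_End_iff by simp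
  qed
qed

end
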